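(* Let $f:\mathbb{R}^m\to\mathbb{R}$ be a $C^1$ function, let $\delta_0>0$ and $0<\alpha,\beta<1$. Assume that $z_\infty\in\mathbb{R}^m$ is a generalised saddle point of $f$. Then for every $\epsilon>0$ there is a non-empty open set $U(z_\infty,\epsilon)\subset\mathcal{D}(z_\infty)\cap B(z_\infty,\epsilon)$, and moreover these sets can be chosen so that the following density 1 property holds: $$\lim_{\epsilon\to 0}\frac{Vol(U(z_\infty,\epsilon))}{Vol(B(z_\infty,\epsilon))}=1.$$
   Context: Generalised saddle point: a critical point $z_\infty$ of the $C^1$ function $f$ (i.e. $\nabla f(z_\infty)=0$) such that $f$ is $C^2$ near $z_\infty$ and the Hessian $\nabla^2f(z_\infty)$ has at least one negative eigenvalue. For $x\in\mathbb{R}^m$, $\delta(f,\delta_0,x)$ is the largest $\sigma$ in $\{\beta^n\delta_0: n=0,1,2,\ldots\}$ for which $f(x-\sigma\nabla f(x))-f(x)\le-\alpha\sigma\|\nabla f(x)\|^2$ (such a $\sigma$ always exists). Given $z_0\in\mathbb{R}^m$, the Backtracking gradient descent sequence starting at $z_0$ is $z_n=z_{n-1}-\delta(f,\delta_0,z_{n-1})\nabla f(z_{n-1})$, $n\ge1$. $\mathcal{D}(z_\infty)$ is the set of $z_0\in\mathbb{R}^m$ such that the Backtracking gradient descent sequence $\{z_n\}$ starting at $z_0$ does not contain any subsequence converging to $z_\infty$. $B(z_\infty,\epsilon)=\{x\in\mathbb{R}^m:\|x-z_\infty\|<\epsilon\}$, and $Vol$ denotes Lebesgue measure on $\mathbb{R}^m$.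 *)

theory Defs
  imports "HOL-Analysis.Analysis"
begin

definition grad :: "(real ^ 'm \<Rightarrow> real) \<Rightarrow> real ^ 'm \<Rightarrow> real ^ 'm" where
  "grad f x = (THE D. GDERIV f x :> D)"

definition hessian :: "(real ^ 'm \<Rightarrow> real) \<Rightarrow> real ^ 'm \<Rightarrow> real ^ 'm ^ 'm" where
  "hessian f x = jacobian (grad f) (at x)"

text \<open>The following two notions are meant for open sets \<open>S\<close>: \<^term>\<open>grad f x\<close> and \<^term>\<open>hessian f x\<close>
  are full (two-sided) derivatives in the ambient space.\<close>

definition C1_on :: "(real ^ 'm) set \<Rightarrow> (real ^ 'm \<Rightarrow> real) \<Rightarrow> bool" where
  "C1_on S f \<longleftrightarrow> f differentiable_on S \<and> continuous_on S (grad f)"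

definition C2_on :: "(real ^ 'm) set \<Rightarrow> (real ^ 'm \<Rightarrow> real) \<Rightarrow> bool" where
  "C2_on S f \<longleftrightarrow> C1_on S f \<and> grad f differentiable_on S \<and> continuous_on S (hessian f)"

definition eigenvalue :: "real ^ 'm ^ 'm \<Rightarrow> real \<Rightarrow> bool" where
  "eigenvalue A c \<longleftrightarrow> (\<exists>v. v \<noteq> 0 \<and> A *v v = c *\<^sub>R v)"

definition generalised_saddle_point :: "(real ^ 'm \<Rightarrow> real) \<Rightarrow> real ^ 'm \<Rightarrow> bool" where
  "generalised_saddle_point f z \<longleftrightarrow>
     grad f z = 0 \<and>
     (\<exists>S. open S \<and> z \<in> S \<and> C2_on S f) \<and>
     (\<exists>c<0. eigenvalue (hessian f z) c)"

definition armijo :: "real \<Rightarrow> (real ^ 'm \<Rightarrow> real) \<Rightarrow> real ^ 'm \<Rightarrow> real \<Rightarrow> bool" where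
  "armijo \<alpha> f x \<sigma> \<longleftrightarrow>
     f (x - \<sigma> *\<^sub>R grad f x) - f x \<le> - \<alpha> * \<sigma> * (norm (grad f x))\<^sup>2"

definition backtracking_delta ::
  "real \<Rightarrow> real \<Rightarrow> (real ^ 'm \<Rightarrow> real) \<Rightarrow> real \<Rightarrow> real ^ 'm \<Rightarrow> real" where
  "backtracking_delta \<alpha> \<beta> f \<delta>\<^sub>0 x =
     (GREATEST \<sigma>. \<sigma> \<in> {\<beta> ^ n * \<delta>\<^sub>0 | n. True} \<and> armijo \<alpha> f x \<sigma>)"

primrec backtracking_gd ::
  "real \<Rightarrow> real \<Rightarrow> (real ^ 'm \<Rightarrow> real) \<Rightarrow> real \<Rightarrow> real ^ 'm \<Rightarrow> nat \<Rightarrow> real ^ 'm" where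
  "backtracking_gd \<alpha> \<beta> f \<delta>\<^sub>0 z\<^sub>0 0 = z\<^sub>0"
| "backtracking_gd \<alpha> \<beta> f \<delta>\<^sub>0 z\<^sub>0 (Suc n) =
     (let z = backtracking_gd \<alpha> \<beta> f \<delta>\<^sub>0 z\<^sub>0 n
      in z - backtracking_delta \<alpha> \<beta> f \<delta>\<^sub>0 z *\<^sub>R grad f z)"

definition non_convergence_domain ::
  "real \<Rightarrow> real \<Rightarrow> (real ^ 'm \<Rightarrow> real) \<Rightarrow> real \<Rightarrow> real ^ 'm \<Rightarrow> (real ^ 'm) set" where
  "non_convergence_domain \<alpha> \<beta> f \<delta>\<^sub>0 z =
     {z\<^sub>0. \<not> (\<exists>r. strict_mono r \<and> (backtracking_gd \<alpha> \<beta> f \<delta>\<^sub>0 z\<^sub>0 \<circ> r) \<longlonglongrightarrow> z)}"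

lemma GDERIV_grad:
  fixes f :: "real ^ 'm \<Rightarrow> real"
  assumes "f differentiable at x"
  shows "GDERIV f x :> grad f x"
proof -
  obtain f' where f': "(f has_derivative f') (at x)"
    using assms by (auto simp: differentiable_def)
  have lin: "linear f'" using f' by (rule has_derivative_linear)
  have eq: "f' = (\<lambda>h. inner h (adjoint f' 1))"
    by (rule ext) (simp add: adjoint_works[OF lin])
  have ex: "GDERIV f x :> adjoint f' 1"
    unfolding gderiv_def by (rule has_derivative_eq_rhs[OF f' eq])
  have "D = D'" if "GDERIV f x :> D" "GDERIV f x :> D'" for D D'
  proof -
    have "(\<lambda>h. inner h D) = (\<lambda>h. inner h D')"
      using that has_derivative_unique unfolding gderiv_def by blast
    then have "\<forall>h. inner h D = inner h D'" by metis
    then show "D = D'" by (simp only: vector_eq_ldot)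
  qed
  with ex have "\<exists>!D. GDERIV f x :> D" by blast
  then show ?thesis unfolding grad_def by (rule theI')
qed

text \<open>The greatest element in \<^const>\<open>backtracking_delta\<close> exists, also at critical points.\<close>

lemma backtracking_delta_greatest:
  fixes f :: "real ^ 'm \<Rightarrow> real"
  assumes "f differentiable at x" "\<delta>\<^sub>0 > 0" "0 < \<alpha>" "\<alpha> < 1" "0 < \<beta>" "\<beta> < 1"
  shows "backtracking_delta \<alpha> \<beta> f \<delta>\<^sub>0 x \<in> {\<beta> ^ n * \<delta>\<^sub>0 | n. True}"
    and "armijo \<alpha> f x (backtracking_delta \<alpha> \<beta> f \<delta>\<^sub>0 x)"
    and "armijo \<alpha> f x (\<beta> ^ k * \<delta>\<^sub>0) \<Longrightarrow> \<beta> ^ k * \<delta>\<^sub>0 \<le> backtracking_delta \<alpha> \<beta> f \<delta>\<^sub>0 x"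
proof -
  let ?g = "grad f x"
  have "\<exists>n. armijo \<alpha> f x (\<beta> ^ n * \<delta>\<^sub>0)"
  proof (cases "?g = 0")
    case True
    then show ?thesis by (simp add: armijo_def)
  next
    case False
    define N where "N = (norm ?g)\<^sup>2"
    have N: "N > 0" using False by (simp add: N_def)
    have "(f has_derivative (\<lambda>h. inner h ?g)) (at (x - 0 *\<^sub>R ?g))"
      using GDERIV_grad[OF assms(1)] by (simp add: gderiv_def)
    moreover have "((\<lambda>s::real. x - s *\<^sub>R ?g) has_derivative (\<lambda>s. - s *\<^sub>R ?g)) (at 0)"
      by (auto intro!: derivative_eq_intros)
    ultimately have "((\<lambda>s. f (x - s *\<^sub>R ?g)) has_derivative (\<lambda>s. inner (- s *\<^sub>R ?g) ?g)) (at 0)"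
      by (rule has_derivative_compose[rotated])
    moreover have "(\<lambda>s. inner (- s *\<^sub>R ?g) ?g) = (*) (- N)"
      by (simp add: N_def power2_norm_eq_inner fun_eq_iff)
    ultimately have "((\<lambda>s. f (x - s *\<^sub>R ?g)) has_real_derivative (- N)) (at 0)"
      by (simp add: has_field_derivative_def)
    then have "((\<lambda>s. (f (x - s *\<^sub>R ?g) - f x) / s) \<longlongrightarrow> - N) (at 0)"
      by (simp add: DERIV_def)
    moreover have "filterlim (\<lambda>n. \<beta> ^ n * \<delta>\<^sub>0) (at 0) sequentially"
      unfolding filterlim_at using assms
      by (auto intro!: tendsto_mult_left_zero LIMSEQ_power_zero)
    ultimately have "(\<lambda>n. (f (x - (\<beta> ^ n * \<delta>\<^sub>0) *\<^sub>R ?g) - f x) / (\<beta> ^ n * \<delta>\<^sub>0)) \<longlonglongrightarrow> - N"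
      by (rule filterlim_compose)
    moreover have "- N < - \<alpha> * N" using N assms by simp
    ultimately have
      "\<forall>\<^sub>F n in sequentially. (f (x - (\<beta> ^ n * \<delta>\<^sub>0) *\<^sub>R ?g) - f x) / (\<beta> ^ n * \<delta>\<^sub>0) < - \<alpha> * N"
      by (rule order_tendstoD(2))
    then obtain n where
      n: "(f (x - (\<beta> ^ n * \<delta>\<^sub>0) *\<^sub>R ?g) - f x) / (\<beta> ^ n * \<delta>\<^sub>0) < - \<alpha> * N"
      by (auto simp: eventually_sequentially)
    have "\<beta> ^ n * \<delta>\<^sub>0 > 0" using assms by simp
    with n have "f (x - (\<beta> ^ n * \<delta>\<^sub>0) *\<^sub>R ?g) - f x < - \<alpha> * N * (\<beta> ^ n * \<delta>\<^sub>0)"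
      by (simp only: pos_divide_less_eq)
    then have "armijo \<alpha> f x (\<beta> ^ n * \<delta>\<^sub>0)"
      by (simp add: armijo_def N_def mult_ac)
    then show ?thesis ..
  qed
  then have least: "armijo \<alpha> f x (\<beta> ^ (LEAST n. armijo \<alpha> f x (\<beta> ^ n * \<delta>\<^sub>0)) * \<delta>\<^sub>0)" (is "armijo _ _ _ (\<beta> ^ ?n * _)")
    by (rule LeastI_ex)
  have max: "\<beta> ^ k * \<delta>\<^sub>0 \<le> \<beta> ^ ?n * \<delta>\<^sub>0" if "armijo \<alpha> f x (\<beta> ^ k * \<delta>\<^sub>0)" for k
  proof -
    have "?n \<le> k" using that by (rule Least_le)
    then show ?thesis using assms by (simp add: power_decreasing)
  qed
  have eq: "backtracking_delta \<alpha> \<beta> f \<delta>\<^sub>0 x = \<beta> ^ ?n * \<delta>\<^sub>0"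
    unfolding backtracking_delta_def by (rule Greatest_equality) (use least max in auto)
  show "backtracking_delta \<alpha> \<beta> f \<delta>\<^sub>0 x \<in> {\<beta> ^ n * \<delta>\<^sub>0 | n. True}" using eq by auto
  show "armijo \<alpha> f x (backtracking_delta \<alpha> \<beta> f \<delta>\<^sub>0 x)" using eq least by simp
  show "\<beta> ^ k * \<delta>\<^sub>0 \<le> backtracking_delta \<alpha> \<beta> f \<delta>\<^sub>0 x" if "armijo \<alpha> f x (\<beta> ^ k * \<delta>\<^sub>0)"
    using eq max[OF that] by simp
qed

end

theory Submission
  imports Defs
begin

text \<open>The values of \<open>f\<close> decrease along the sequence, so no orbit that reaches a value below \<open>f z\<close>
  accumulates at \<open>z\<close>. Let \<open>w\<close> be a unit left eigenvector of the Hessian at \<open>z\<close> for a negative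
  eigenvalue \<open>- \<mu>\<close>. Close to \<open>z\<close> the step sizes are bounded below by some \<open>s > 0\<close> and
  \<open>\<bar>(x - z) \<bullet> w\<bar>\<close> does not decrease, provided that it is not small compared with the error of the
  linearised gradient; each step then lowers \<open>f\<close> by at least \<open>c ((x\<^sub>0 - z) \<bullet> w)\<^sup>2\<close>, where
  \<open>c = \<alpha> s \<mu>\<^sup>2 / 4\<close>. For \<open>x\<^sub>0\<close> in the double cone \<open>\<bar>(x - z) \<bullet> w\<bar> > \<eta> \<bar>x - z\<bar>\<close> the initial excess
  \<open>f x\<^sub>0 - f z\<close> is at most \<open>L / \<eta>\<^sup>2 ((x\<^sub>0 - z) \<bullet> w)\<^sup>2\<close>, so a number \<open>K\<close> of steps depending only on
  \<open>\<eta>\<close> suffices; since \<open>\<bar>x - z\<bar>\<close> grows at most geometrically, the linearisation error is controlled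
  during these \<open>K\<close> steps once \<open>x\<^sub>0\<close> is close to \<open>z\<close>. Hence the cone with aperture \<open>\<eta>\<close>, near \<open>z\<close>,
  lies in the domain of non-convergence, and its density tends to 1 as \<open>\<eta>\<close> tends to 0.\<close>

section \<open>Double cones and their density at the apex\<close>

text \<open>For a unit vector \<open>w\<close>, membership says that the angle between
  \<open>x - z\<close> and the line spanned by \<open>w\<close> has \<bar>cosine\<bar> above \<eta>.
  Strictness makes the set open and excludes the apex; a smaller \<eta> gives a wider cone.\<close>

definition double_cone :: "'a::real_inner \<Rightarrow> 'a \<Rightarrow> real \<Rightarrow> 'a set" where
  "double_cone z w \<eta> = {x. \<eta> * norm (x - z) < \<bar>(x - z) \<bullet> w\<bar>}"

lemma open_double_cone: "open (double_cone z w \<eta>)"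
  unfolding double_cone_def by (intro open_Collect_less continuous_intros)

lemma affine_image_double_cone:
  fixes z w :: "'a::real_inner"
  assumes "0 < \<epsilon>"
  shows "(\<lambda>x. \<epsilon> *\<^sub>R x + z) ` (double_cone 0 w \<eta> \<inter> ball 0 1) = double_cone z w \<eta> \<inter> ball z \<epsilon>"
proof -
  have iff: "\<epsilon> *\<^sub>R y + z \<in> double_cone z w \<eta> \<inter> ball z \<epsilon> \<longleftrightarrow> y \<in> double_cone 0 w \<eta> \<inter> ball 0 1" for y
  proof -
    have "\<eta> * (\<epsilon> * norm y) < \<epsilon> * \<bar>y \<bullet> w\<bar> \<longleftrightarrow> \<eta> * norm y < \<bar>y \<bullet> w\<bar>"
      using assms by (simp add: mult.left_commute)
    then show ?thesis using assms by (simp add: double_cone_def dist_norm abs_mult)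
  qed
  show ?thesis
  proof (intro equalityI subsetI)
    fix x assume x: "x \<in> double_cone z w \<eta> \<inter> ball z \<epsilon>"
    have "x = \<epsilon> *\<^sub>R (inverse \<epsilon> *\<^sub>R (x - z)) + z"
      using assms by simp
    with x show "x \<in> (\<lambda>x. \<epsilon> *\<^sub>R x + z) ` (double_cone 0 w \<eta> \<inter> ball 0 1)"
      using iff by (metis image_eqI)
  qed (use iff in blast)
qed

text \<open>Both sides of the cone inequality are homogeneous in \<open>x - z\<close>. Translation
  and dilation therefore carry the unit picture to radius \<epsilon>, and the common factor
  \<open>\<epsilon> ^ DIM('a)\<close> cancels.\<close>

lemma measure_double_cone_ball:
  fixes z w :: "'a::euclidean_space"
  assumes "0 < \<epsilon>"
  shows "measure lebesgue (double_cone z w \<eta> \<inter> ball z \<epsilon>) / measure lebesgue (ball z \<epsilon>)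
    = measure lebesgue (double_cone 0 w \<eta> \<inter> ball 0 1) / measure lebesgue (ball (0::'a) 1)"
proof -
  let ?C = "double_cone 0 w \<eta> \<inter> ball 0 1"
  have C: "?C \<in> lmeasurable"
    by (intro lmeasurable_open open_Int open_double_cone open_ball bounded_Int) auto
  have "double_cone z w \<eta> \<inter> ball z \<epsilon> = (+) z ` ((*\<^sub>R) \<epsilon> ` ?C)"
    unfolding affine_image_double_cone[OF assms, symmetric] by (auto simp: image_image add.commute)
  then have "measure lebesgue (double_cone z w \<eta> \<inter> ball z \<epsilon>) = \<epsilon> ^ DIM('a) * measure lebesgue ?C"
    using assms by (simp add: measure_translation measure_lebesgue_affine[of \<epsilon> 0, simplified])
  moreover have "measure lebesgue (ball z \<epsilon>) = \<epsilon> ^ DIM('a) * measure lebesgue (ball (0::'a) 1)"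
    using content_ball_conv_unit_ball[of \<epsilon> z] assms by simp
  ultimately show ?thesis using assms by simp
qed

text \<open>The truncated cones increase to the unit ball minus the hyperplane orthogonal to
  \<open>w\<close>, which is negligible.\<close>

lemma double_cone_volume_tendsto:
  fixes w :: "'a::euclidean_space"
  assumes "w \<noteq> 0"
  shows "(\<lambda>n. measure lebesgue (double_cone 0 w (inverse (real (Suc n))) \<inter> ball 0 1))
    \<longlonglongrightarrow> measure lebesgue (ball (0::'a) 1)"
proof -
  let ?C = "\<lambda>n. double_cone 0 w (inverse (real (Suc n))) \<inter> ball 0 1"
  have meas: "?C n \<in> lmeasurable" for n
    by (intro lmeasurable_open open_Int open_double_cone open_ball bounded_Int) auto
  have mono: "?C n \<subseteq> ?C (Suc n)" for n
  proof -
    have "inverse (real (Suc (Suc n))) * norm x \<le> inverse (real (Suc n)) * norm x" for x :: 'a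
      by (intro mult_right_mono) (auto simp: field_simps)
    then show ?thesis unfolding double_cone_def by (auto intro: le_less_trans)
  qed
  have bound: "measure lebesgue (?C n) \<le> measure lebesgue (ball (0::'a) 1)" for n
    by (intro measure_mono_fmeasurable) (use meas in \<open>auto intro: fmeasurableD\<close>)
  have Un: "(\<Union>n. ?C n) = ball 0 1 - {x. w \<bullet> x = 0}"
  proof (intro equalityI subsetI)
    fix x assume x: "x \<in> ball 0 1 - {x. w \<bullet> x = 0}"
    then have pos: "0 < \<bar>x \<bullet> w\<bar>" by (simp add: inner_commute)
    then obtain n where n: "inverse (real (Suc n)) < \<bar>x \<bullet> w\<bar>"
      using reals_Archimedean by blast
    have "inverse (real (Suc n)) * norm x \<le> inverse (real (Suc n)) * 1"
      using x by (intro mult_left_mono) auto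
    with n have "inverse (real (Suc n)) * norm x < \<bar>x \<bullet> w\<bar>" by linarith
    with x show "x \<in> (\<Union>n. ?C n)"
      unfolding double_cone_def by (auto simp del: of_nat_Suc)
  qed (auto simp: double_cone_def inner_commute mult_less_0_iff)
  have "(\<lambda>n. measure lebesgue (?C n)) \<longlonglongrightarrow> measure lebesgue (\<Union>n. ?C n)"
    by (intro measure_nested_Union meas mono) (rule bound)
  moreover have "measure lebesgue (\<Union>n. ?C n) = measure lebesgue (ball (0::'a) 1)"
    unfolding Un by (intro measure_negligible_symdiff)
     (auto intro!: negligible_subset[OF negligible_hyperplane[of w 0]] simp: assms)
  ultimately show ?thesis by simp
qed

section \<open>Linear algebra and first-order estimates at the saddle point\<close>

text \<open>Using a left eigenvector avoids the symmetry of the Hessian.\<close>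

lemma left_eigenvector:
  fixes A :: "real ^ 'n ^ 'n"
  assumes "eigenvalue A c"
  obtains w where "norm w = 1" "\<And>x. (A *v x) \<bullet> w = c * (x \<bullet> w)"
proof -
  let ?B = "A - c *\<^sub>R mat 1"
  have B: "?B *v x = A *v x - c *\<^sub>R x" for x
    by (simp add: matrix_vector_mult_diff_rdistrib scaleR_matrix_vector_assoc[symmetric])
  obtain v where "v \<noteq> 0" "A *v v = c *\<^sub>R v" using assms unfolding eigenvalue_def by blast
  \<comment> \<open>A singular matrix has a singular transpose, by the determinant; a kernel vector
    of the transpose is the left eigenvector.\<close>
  then have "\<not> invertible ?B"
    by (metis B right_minus_eq invertible_left_inverse matrix_left_invertible_ker)
  then have "\<not> invertible (transpose ?B)" by (metis invertible_det_nz det_transpose)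
  then obtain u where u: "u \<noteq> 0" "transpose ?B *v u = 0"
    by (metis invertible_left_inverse matrix_left_invertible_ker)
  define w where "w = u /\<^sub>R norm u"
  have "(A *v x) \<bullet> w = c * (x \<bullet> w)" for x
  proof -
    have "(?B *v x) \<bullet> u = x \<bullet> (transpose ?B *v u)"
      by (metis dot_lmul_matrix inner_commute transpose_matrix_vector transpose_transpose)
    then have "(A *v x) \<bullet> u = c * (x \<bullet> u)" using u by (simp add: B inner_diff_left)
    then show ?thesis by (simp add: w_def)
  qed
  moreover have "norm w = 1" using u by (simp add: w_def)
  ultimately show ?thesis using that by blast
qed

lemma grad_mvt:
  fixes f :: "real ^ 'm \<Rightarrow> real"
  assumes "\<And>x. f differentiable at x"
  obtains t where "0 \<le> t" "t \<le> 1" "f (x + h) - f x = h \<bullet> grad f (x + t *\<^sub>R h)"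
proof -
  have "((\<lambda>s. f (x + s *\<^sub>R h)) has_derivative (\<lambda>k. (k *\<^sub>R h) \<bullet> grad f (x + s *\<^sub>R h))) (at s)" for s
  proof -
    have "(f has_derivative (\<lambda>k. k \<bullet> grad f (x + s *\<^sub>R h))) (at (x + s *\<^sub>R h))"
      using GDERIV_grad[OF assms, of "x + s *\<^sub>R h"] unfolding gderiv_def .
    moreover have "((\<lambda>s. x + s *\<^sub>R h) has_derivative (\<lambda>k. k *\<^sub>R h)) (at s)"
      by (auto intro!: derivative_eq_intros)
    ultimately show ?thesis by (rule has_derivative_compose[rotated])
  qed
  then have "\<exists>t\<in>{0..1::real}. f (x + 1 *\<^sub>R h) - f (x + 0 *\<^sub>R h) = ((1 - 0) *\<^sub>R h) \<bullet> grad f (x + t *\<^sub>R h)"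
    by (intro mvt_very_simple) (auto intro: has_derivative_at_withinI)
  then show ?thesis using that by auto
qed

text \<open>Continuity of the Hessian at \<open>z\<close> bounds its entries on a small ball;
  convexity of the ball turns this into a Lipschitz bound by the mean value inequality.\<close>

lemma C2_on_grad_lipschitz:
  fixes f :: "real ^ 'm \<Rightarrow> real"
  assumes "open S" "z \<in> S" "C2_on S f"
  obtains R L where "0 < R" "0 < L"
    "\<And>x y. x \<in> ball z R \<Longrightarrow> y \<in> ball z R \<Longrightarrow> norm (grad f x - grad f y) \<le> L * norm (x - y)"
proof -
  have "isCont (hessian f) z"
    using assms by (auto simp: C2_on_def continuous_on_eq_continuous_at)
  then obtain d where d: "0 < d" "\<And>x. dist x z < d \<Longrightarrow> dist (hessian f x) (hessian f z) < 1"
    unfolding continuous_at_eps_delta by (meson zero_less_one)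
  obtain e where e: "0 < e" "ball z e \<subseteq> S" using assms openE by blast
  define R where "R = min d e"
  define B where "B = norm (hessian f z) + 1"
  \<comment> \<open>The operator norm is at most the number of entries times a bound
    \<open>B\<close> on their absolute values.\<close>
  define L where "L = real CARD('m) * real CARD('m) * B"
  have "0 < B" by (simp add: B_def add_nonneg_pos)
  then have "0 < L" by (simp add: L_def)
  have der: "(grad f has_derivative (*v) (hessian f x)) (at x)" if "x \<in> ball z R" for x
  proof -
    have "x \<in> S" using that e by (auto simp: R_def)
    then have "grad f differentiable at x"
      using assms by (auto simp: C2_on_def differentiable_on_eq_differentiable_at)
    then show ?thesis unfolding hessian_def by (simp add: jacobian_works)
  qed
  have bnd: "onorm ((*v) (hessian f x)) \<le> L" if "x \<in> ball z R" for x
    unfolding L_def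
  proof (rule onorm_le_matrix_component)
    fix i j
    have "\<bar>hessian f x $ i $ j\<bar> \<le> norm (hessian f x)"
      using component_le_norm_cart[of "hessian f x $ i" j] Finite_Cartesian_Product.norm_nth_le[of "hessian f x" i]
      by simp
    moreover have "norm (hessian f x) \<le> norm (hessian f z) + dist (hessian f x) (hessian f z)"
      by (simp add: dist_norm norm_triangle_sub)
    moreover have "dist (hessian f x) (hessian f z) < 1"
      using that d by (auto simp: R_def dist_commute)
    ultimately show "\<bar>hessian f x $ i $ j\<bar> \<le> B" by (simp add: B_def)
  qed
  show ?thesis
  proof (rule that[of R L])
    show "0 < R" using d e by (simp add: R_def)
    show "norm (grad f x - grad f y) \<le> L * norm (x - y)" if "x \<in> ball z R" "y \<in> ball z R" for x y
      using differentiable_bound[OF convex_ball has_derivative_at_withinI[OF der] bnd] that by blast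
  qed fact
qed


section \<open>Step sizes and the effect of a single step\<close>

lemma backtracking_delta_bounds:
  fixes f :: "real ^ 'm \<Rightarrow> real"
  assumes "f differentiable at x" "\<delta>\<^sub>0 > 0" "0 < \<alpha>" "\<alpha> < 1" "0 < \<beta>" "\<beta> < 1"
  shows "0 < backtracking_delta \<alpha> \<beta> f \<delta>\<^sub>0 x" "backtracking_delta \<alpha> \<beta> f \<delta>\<^sub>0 x \<le> \<delta>\<^sub>0"
proof -
  obtain n where "backtracking_delta \<alpha> \<beta> f \<delta>\<^sub>0 x = \<beta> ^ n * \<delta>\<^sub>0"
    using backtracking_delta_greatest(1)[OF assms] by blast
  then show "0 < backtracking_delta \<alpha> \<beta> f \<delta>\<^sub>0 x" "backtracking_delta \<alpha> \<beta> f \<delta>\<^sub>0 x \<le> \<delta>\<^sub>0"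
    using assms by (simp_all add: power_le_one)
qed

text \<open>Along the step the gradient changes by at most
  \<open>(1 - \<alpha>) * norm (grad f x)\<close>, so the slope of descent keeps at least the
  fraction \<alpha> of its initial value. This yields a lower bound for backtracking steps that is
  uniform near \<open>z\<close>.\<close>

lemma armijo_if_grad_lipschitz:
  fixes f :: "real ^ 'm \<Rightarrow> real"
  assumes diff: "\<And>x. f differentiable at x"
    and lip: "\<And>x y. x \<in> S \<Longrightarrow> y \<in> S \<Longrightarrow> norm (grad f x - grad f y) \<le> L * norm (x - y)"
    and "convex S" "x \<in> S" "x - \<sigma> *\<^sub>R grad f x \<in> S" "0 \<le> \<sigma>" "0 \<le> L" "L * \<sigma> \<le> 1 - \<alpha>"
  shows "armijo \<alpha> f x \<sigma>"
proof -
  let ?g = "grad f x"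
  let ?h = "- (\<sigma> *\<^sub>R ?g)"
  obtain t where t: "0 \<le> t" "t \<le> 1" and eq: "f (x + ?h) - f x = ?h \<bullet> grad f (x + t *\<^sub>R ?h)"
    using grad_mvt[OF diff] by blast
  let ?y = "x + t *\<^sub>R ?h"
  have "?y = (1 - t) *\<^sub>R x + t *\<^sub>R (x - \<sigma> *\<^sub>R ?g)" by (simp add: algebra_simps)
  then have "?y \<in> S" using assms t by (simp add: convexD_alt)
  then have "norm (grad f ?y - ?g) \<le> L * (t * (\<sigma> * norm ?g))"
    using lip[of ?y x] assms t by (simp add: abs_mult)
  also have "\<dots> \<le> L * (1 * (\<sigma> * norm ?g))"
    using assms t by (intro mult_left_mono mult_right_mono) auto
  finally have n: "norm (grad f ?y - ?g) \<le> L * \<sigma> * norm ?g" by (simp add: mult_ac)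
  have "?g \<bullet> grad f ?y = (norm ?g)\<^sup>2 + ?g \<bullet> (grad f ?y - ?g)"
    by (simp add: power2_norm_eq_inner inner_diff_right)
  moreover have "\<bar>?g \<bullet> (grad f ?y - ?g)\<bar> \<le> norm ?g * (L * \<sigma> * norm ?g)"
    by (rule order_trans[OF Cauchy_Schwarz_ineq2 mult_left_mono[OF n]]) simp
  moreover have "norm ?g * (L * \<sigma> * norm ?g) \<le> (1 - \<alpha>) * (norm ?g)\<^sup>2"
    using mult_right_mono[OF \<open>L * \<sigma> \<le> 1 - \<alpha>\<close>, of "(norm ?g)\<^sup>2"] by (simp add: power2_eq_square mult_ac)
  ultimately have "\<alpha> * (norm ?g)\<^sup>2 \<le> ?g \<bullet> grad f ?y"
    by (simp add: algebra_simps)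
  then have "\<sigma> * (\<alpha> * (norm ?g)\<^sup>2) \<le> \<sigma> * (?g \<bullet> grad f ?y)"
    using assms by (intro mult_left_mono)
  then show ?thesis using eq by (simp add: armijo_def mult_ac)
qed

text \<open>Here \<open>y\<close> is the displacement from the saddle and \<open>g\<close> the
  gradient. An error of at most half the linear term leaves \<open>g \<bullet> w\<close> with sign
  (weakly) opposite to \<open>y \<bullet> w\<close>, so a step along \<open>- g\<close> pushes the
  \<open>w\<close>-component away from 0.\<close>

lemma expanding_step:
  fixes y g w :: "'a::real_inner"
  assumes "\<bar>g \<bullet> w + \<mu> * (y \<bullet> w)\<bar> \<le> \<mu> / 2 * \<bar>y \<bullet> w\<bar>" "0 \<le> \<sigma>" "0 \<le> \<mu>" "norm w = 1"
  shows "\<bar>y \<bullet> w\<bar> \<le> \<bar>(y - \<sigma> *\<^sub>R g) \<bullet> w\<bar>" "\<mu> / 2 * \<bar>y \<bullet> w\<bar> \<le> norm g"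
proof -
  define a b where "a = y \<bullet> w" and "b = g \<bullet> w"
  have *: "\<bar>b + \<mu> * a\<bar> \<le> \<mu> / 2 * \<bar>a\<bar>" using assms by (simp add: a_def b_def)
  have ab: "(0 \<le> a \<and> b \<le> - (\<mu> / 2 * a)) \<or> (a \<le> 0 \<and> - (\<mu> / 2 * a) \<le> b)"
  proof (cases "0 \<le> a")
    case True
    then have "b + \<mu> * a \<le> \<mu> / 2 * a" using * abs_ge_self[of "b + \<mu> * a"] by simp
    then have "b \<le> - (\<mu> / 2 * a)" by (simp add: field_simps)
    with True show ?thesis by blast
  next
    case False
    then have "- (b + \<mu> * a) \<le> - (\<mu> / 2 * a)" using * abs_ge_minus_self[of "b + \<mu> * a"] by simp
    then have "- (\<mu> / 2 * a) \<le> b" by (simp add: field_simps)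
    with False show ?thesis by linarith
  qed
  moreover have "0 \<le> a \<Longrightarrow> 0 \<le> \<mu> / 2 * a" "a \<le> 0 \<Longrightarrow> \<mu> / 2 * a \<le> 0"
    using assms by (simp_all add: mult_nonneg_nonpos)
  ultimately have "(0 \<le> a \<and> b \<le> 0) \<or> (a \<le> 0 \<and> 0 \<le> b)" by linarith
  then have "(0 \<le> a \<and> \<sigma> * b \<le> 0) \<or> (a \<le> 0 \<and> 0 \<le> \<sigma> * b)"
    using assms by (auto simp: mult_nonneg_nonpos)
  then have "\<bar>a\<bar> \<le> \<bar>a - \<sigma> * b\<bar>" by linarith
  then show "\<bar>y \<bullet> w\<bar> \<le> \<bar>(y - \<sigma> *\<^sub>R g) \<bullet> w\<bar>"
    by (simp add: a_def b_def inner_diff_left)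
  have "\<mu> / 2 * \<bar>a\<bar> \<le> \<bar>b\<bar>" using ab by (auto simp: abs_if)
  also have "\<dots> \<le> norm g" using Cauchy_Schwarz_ineq2[of g w] assms by (simp add: b_def)
  finally show "\<mu> / 2 * \<bar>y \<bullet> w\<bar> \<le> norm g" by (simp add: a_def)
qed

section \<open>Descent of the values and escape from the cone\<close>

lemma backtracking_gd_antimono:
  fixes f :: "real ^ 'm \<Rightarrow> real"
  assumes "\<And>x. f differentiable at x" "\<delta>\<^sub>0 > 0" "0 < \<alpha>" "\<alpha> < 1" "0 < \<beta>" "\<beta> < 1"
  shows "antimono (\<lambda>n. f (backtracking_gd \<alpha> \<beta> f \<delta>\<^sub>0 x n))"
proof (rule decseq_SucI)
  fix n
  let ?z = "backtracking_gd \<alpha> \<beta> f \<delta>\<^sub>0 x n"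
  have "armijo \<alpha> f ?z (backtracking_delta \<alpha> \<beta> f \<delta>\<^sub>0 ?z)"
    by (rule backtracking_delta_greatest(2)[OF assms])
  moreover have "0 \<le> \<alpha> * backtracking_delta \<alpha> \<beta> f \<delta>\<^sub>0 ?z * (norm (grad f ?z))\<^sup>2"
    using backtracking_delta_bounds(1)[OF assms, of ?z] assms by simp
  ultimately show "f (backtracking_gd \<alpha> \<beta> f \<delta>\<^sub>0 x (Suc n)) \<le> f ?z"
    by (simp add: armijo_def Let_def)
qed

lemma non_convergence_domain_if_below:
  fixes f :: "real ^ 'm \<Rightarrow> real"
  assumes "\<And>x. f differentiable at x" "\<delta>\<^sub>0 > 0" "0 < \<alpha>" "\<alpha> < 1" "0 < \<beta>" "\<beta> < 1"
    and below: "f (backtracking_gd \<alpha> \<beta> f \<delta>\<^sub>0 x k) < f z"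
  shows "x \<in> non_convergence_domain \<alpha> \<beta> f \<delta>\<^sub>0 z"
proof -
  let ?X = "backtracking_gd \<alpha> \<beta> f \<delta>\<^sub>0 x"
  have False if r: "strict_mono r" and lim: "(?X \<circ> r) \<longlonglongrightarrow> z" for r
  proof -
    have "isCont f z" using assms(1) by (simp add: differentiable_imp_continuous_within)
    then have "(\<lambda>n. f (?X (r n))) \<longlonglongrightarrow> f z"
      using lim unfolding o_def by (rule isCont_tendsto_compose)
    \<comment> \<open>A strictly increasing \<open>r\<close> satisfies \<open>n \<le> r n\<close>,
      so the subsequence is past index \<open>k\<close> once \<open>n\<close> is.\<close>
    moreover have "f (?X (r n)) \<le> f (?X k)" if "k \<le> n" for n
      using backtracking_gd_antimono[OF assms(1-6)] order_trans[OF that seq_suble[OF r]]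
      by (rule antimonoD)
    ultimately have "f z \<le> f (?X k)"
      by (intro LIMSEQ_le_const2) auto
    with below show False by simp
  qed
  then show ?thesis by (auto simp: non_convergence_domain_def)
qed

text \<open>The order of choices matters: the number of steps \<open>K\<close> depends on \<eta> but
  not on the starting point; the tolerance \<kappa> and then the radius \<open>r\<close> are fitted
  to \<open>K\<close>.\<close>

lemma double_cone_escapes:
  fixes f :: "real ^ 'm \<Rightarrow> real"
  assumes diff: "\<And>x. f differentiable at x"
    and par: "\<delta>\<^sub>0 > 0" "0 < \<alpha>" "\<alpha> < 1" "0 < \<beta>" "\<beta> < 1"
    and crit: "grad f z = 0"
    and lip: "0 < R" "0 < L"
      "\<And>x y. x \<in> ball z R \<Longrightarrow> y \<in> ball z R \<Longrightarrow> norm (grad f x - grad f y) \<le> L * norm (x - y)"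
    and der: "(grad f has_derivative (*v) A) (at z)"
    and w: "norm w = 1" "\<And>x. (A *v x) \<bullet> w = - \<mu> * (x \<bullet> w)" "0 < \<mu>"
    and "0 < \<eta>"
  obtains r where "0 < r" "double_cone z w \<eta> \<inter> ball z r \<subseteq> non_convergence_domain \<alpha> \<beta> f \<delta>\<^sub>0 z"
proof -
  \<comment> \<open>Bounds the growth of the distance to \<open>z\<close> in one step, since steps
    are at most \<open>\<delta>\<^sub>0\<close> and the gradient is at most \<open>L\<close> times
    the distance.\<close>
  define M where "M = 1 + \<delta>\<^sub>0 * L"
  have M: "1 \<le> M" using par lip by (simp add: M_def)
  \<comment> \<open>Makes \<open>s\<close> a candidate step size small enough for
    \<open>armijo_if_grad_lipschitz\<close>.\<close>
  obtain m where m: "\<beta> ^ m < (1 - \<alpha>) / (L * \<delta>\<^sub>0)"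
    using real_arch_pow_inv[of "(1 - \<alpha>) / (L * \<delta>\<^sub>0)" \<beta>] par lip by auto
  define s where "s = \<beta> ^ m * \<delta>\<^sub>0"
  have s: "0 < s" "s \<le> \<delta>\<^sub>0" "L * s \<le> 1 - \<alpha>"
    using m par lip by (simp_all add: s_def power_le_one field_simps)
  \<comment> \<open>A step of at least \<open>s\<close> with gradient norm at least
    \<open>\<mu> / 2 * a\<close> lowers \<open>f\<close> by at least
    \<open>c * a\<^sup>2\<close>.\<close>
  define c where "c = \<alpha> * s * (\<mu> / 2)\<^sup>2"
  have c: "0 < c" using par s w by (simp add: c_def)
  obtain K :: nat where K: "L / \<eta>\<^sup>2 / c < real K" using reals_Archimedean2 by blast
  \<comment> \<open>Chosen so that \<open>\<kappa> * M ^ K * norm (x - z)\<close> equals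
    \<open>\<mu> / 2 * (\<eta> * norm (x - z))\<close>, which is below \<open>\<mu> / 2 * a\<close>
    in the cone.\<close>
  define \<kappa> where "\<kappa> = \<mu> * \<eta> / (2 * M ^ K)"
  have \<kappa>: "0 < \<kappa>" using w M \<open>0 < \<eta>\<close> by (simp add: \<kappa>_def)
  then obtain d where d: "0 < d"
    "\<And>y. norm (y - z) < d \<Longrightarrow> norm (grad f y - grad f z - A *v (y - z)) \<le> \<kappa> * norm (y - z)"
    using der unfolding has_derivative_at_alt by blast
  \<comment> \<open>Keeps the iterates up to index \<open>K\<close>, and also their trial points,
    within distance \<open>min R d\<close> of \<open>z\<close>.\<close>
  define r where "r = min R d / M ^ Suc K"
  have r: "0 < r" using d lip M by (simp add: r_def)
  have "x \<in> non_convergence_domain \<alpha> \<beta> f \<delta>\<^sub>0 z" if x: "x \<in> double_cone z w \<eta> \<inter> ball z r" for x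
  proof -
    define X where "X = backtracking_gd \<alpha> \<beta> f \<delta>\<^sub>0 x"
    have X0: "X 0 = x" by (simp add: X_def)
    define a where "a = \<bar>(x - z) \<bullet> w\<bar>"
    have a: "\<eta> * norm (x - z) < a" using x by (simp add: double_cone_def a_def)
    have xr: "norm (x - z) * M ^ Suc K < min R d"
      using x M by (simp add: r_def dist_norm norm_minus_commute pos_less_divide_eq del: power_Suc)
    have "norm (X k - z) \<le> M ^ k * norm (x - z) \<and> a \<le> \<bar>(X k - z) \<bullet> w\<bar> \<and>
      f (X k) \<le> f x - real k * (c * a\<^sup>2)" if "k \<le> K" for k
      using that
    proof (induction k)
      case 0
      then show ?case by (simp add: X0 a_def)
    next
      case (Suc k)
      define y g \<sigma> where "y = X k" and "g = grad f y" and "\<sigma> = backtracking_delta \<alpha> \<beta> f \<delta>\<^sub>0 y"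
      have step: "X (Suc k) = y - \<sigma> *\<^sub>R g" by (simp add: X_def y_def g_def \<sigma>_def Let_def)
      have IH: "norm (y - z) \<le> M ^ k * norm (x - z)" "a \<le> \<bar>(y - z) \<bullet> w\<bar>"
        "f y \<le> f x - real k * (c * a\<^sup>2)"
        using Suc by (auto simp: y_def)
      have "M ^ k * norm (x - z) \<le> M ^ K * norm (x - z)"
        using M Suc by (intro mult_right_mono power_increasing) auto
      with IH have yK: "norm (y - z) \<le> M ^ K * norm (x - z)" by linarith
      have "M * norm (y - z) \<le> M * (M ^ K * norm (x - z))"
        using yK M by (intro mult_left_mono) auto
      then have yM: "M * norm (y - z) < min R d" using xr by (simp add: mult_ac)
      have "1 * norm (y - z) \<le> M * norm (y - z)" using M by (intro mult_right_mono) auto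
      with yM have yR: "norm (y - z) < R" "norm (y - z) < d" by auto
      have gL: "norm g \<le> L * norm (y - z)"
        using lip(3)[of y z] yR lip(1) by (simp add: g_def crit dist_norm norm_minus_commute)
      \<comment> \<open>Stated for all \<tau> because it serves both the trial step \<open>s\<close>
        and the actual step \<sigma>.\<close>
      have moved: "norm (y - \<tau> *\<^sub>R g - z) \<le> M * norm (y - z)" if "0 \<le> \<tau>" "\<tau> \<le> \<delta>\<^sub>0" for \<tau>
      proof -
        have "norm (y - \<tau> *\<^sub>R g - z) \<le> norm (y - z) + \<tau> * norm g"
          using norm_triangle_ineq4[of "y - z" "\<tau> *\<^sub>R g"] that by (simp add: algebra_simps)
        also have "\<tau> * norm g \<le> \<delta>\<^sub>0 * (L * norm (y - z))"
          using that gL by (intro mult_mono) auto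
        finally show ?thesis by (simp add: M_def algebra_simps)
      qed
      have "armijo \<alpha> f y s"
      proof (rule armijo_if_grad_lipschitz[OF diff lip(3)])
        show "y - s *\<^sub>R grad f y \<in> ball z R"
          using moved[of s] s yM by (simp add: g_def dist_norm norm_minus_commute)
      qed (use yR s lip in \<open>auto simp: dist_norm norm_minus_commute\<close>)
      then have \<sigma>s: "s \<le> \<sigma>"
        using backtracking_delta_greatest(3)[OF diff par] by (simp add: s_def \<sigma>_def)
      have \<sigma>: "0 < \<sigma>" "\<sigma> \<le> \<delta>\<^sub>0"
        using backtracking_delta_bounds[OF diff par] by (simp_all add: \<sigma>_def)
      \<comment> \<open>The left eigenvector identity turns this quantity into the linearisation
        error paired with \<open>w\<close>.\<close>
      have "\<bar>g \<bullet> w + \<mu> * ((y - z) \<bullet> w)\<bar> = \<bar>(g - A *v (y - z)) \<bullet> w\<bar>"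
        by (simp add: inner_diff_left[of g] w)
      also have "\<dots> \<le> norm (g - A *v (y - z))"
        using Cauchy_Schwarz_ineq2[of _ w] w by (metis mult.right_neutral)
      also have "\<dots> \<le> \<kappa> * norm (y - z)" using d(2)[OF yR(2)] by (simp add: crit g_def)
      also have "\<dots> \<le> \<kappa> * (M ^ K * norm (x - z))" using yK \<kappa> by (intro mult_left_mono) auto
      also have "\<dots> = \<mu> / 2 * (\<eta> * norm (x - z))" using M by (simp add: \<kappa>_def)
      also have "\<dots> \<le> \<mu> / 2 * \<bar>(y - z) \<bullet> w\<bar>" using a IH w by (intro mult_left_mono) auto
      finally have exp: "\<bar>g \<bullet> w + \<mu> * ((y - z) \<bullet> w)\<bar> \<le> \<mu> / 2 * \<bar>(y - z) \<bullet> w\<bar>" .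
      note exp = expanding_step[OF this less_imp_le[OF \<sigma>(1)] less_imp_le[OF w(3)] w(1)]
      have grow: "a \<le> \<bar>(X (Suc k) - z) \<bullet> w\<bar>"
        using exp(1) IH by (simp add: step algebra_simps)
      have "\<mu> / 2 * a \<le> \<mu> / 2 * \<bar>(y - z) \<bullet> w\<bar>" using IH w by (intro mult_left_mono) auto
      with exp(2) have "\<mu> / 2 * a \<le> norm g" by linarith
      then have "(\<mu> / 2 * a)\<^sup>2 \<le> (norm g)\<^sup>2"
        using w by (intro power_mono) (auto simp: a_def)
      then have "\<alpha> * s * (\<mu> / 2 * a)\<^sup>2 \<le> \<alpha> * \<sigma> * (norm g)\<^sup>2"
        using par s \<sigma>s by (intro mult_mono) auto
      then have "c * a\<^sup>2 \<le> \<alpha> * \<sigma> * (norm g)\<^sup>2" by (simp only: c_def power_mult_distrib mult_ac)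
      moreover have "f (X (Suc k)) - f y \<le> - \<alpha> * \<sigma> * (norm g)\<^sup>2"
        using backtracking_delta_greatest(2)[OF diff par, of y] by (simp add: armijo_def step g_def \<sigma>_def)
      ultimately have "f (X (Suc k)) \<le> f x - real (Suc k) * (c * a\<^sup>2)"
        using IH by (simp add: algebra_simps)
      moreover have "norm (X (Suc k) - z) \<le> M ^ Suc k * norm (x - z)"
      proof -
        have "norm (X (Suc k) - z) \<le> M * norm (y - z)" using moved[of \<sigma>] \<sigma> by (simp add: step)
        also have "\<dots> \<le> M * (M ^ k * norm (x - z))" using IH M by (intro mult_left_mono) auto
        finally show ?thesis by simp
      qed
      ultimately show ?case using grow by blast
    qed
    then have fK: "f (X K) \<le> f x - real K * (c * a\<^sup>2)" by blast
    have "1 * norm (x - z) \<le> M ^ Suc K * norm (x - z)"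
      using M by (intro mult_right_mono one_le_power) auto
    then have xR: "norm (x - z) < R" using xr by (simp add: mult_ac)
    \<comment> \<open>The gradient vanishes at \<open>z\<close>, so the Lipschitz bound makes the
      initial excess at most quadratic in the distance.\<close>
    obtain t where t: "0 \<le> t" "t \<le> 1" and "f (z + (x - z)) - f z = (x - z) \<bullet> grad f (z + t *\<^sub>R (x - z))"
      using grad_mvt[OF diff] by blast
    then have "f x - f z \<le> norm (x - z) * norm (grad f (z + t *\<^sub>R (x - z)))"
      using norm_cauchy_schwarz by simp
    also have "\<dots> \<le> norm (x - z) * (L * norm (x - z))"
    proof (rule mult_left_mono)
      have tx: "t * norm (x - z) \<le> 1 * norm (x - z)" using t by (intro mult_right_mono) auto
      then have "norm (grad f (z + t *\<^sub>R (x - z))) \<le> L * (t * norm (x - z))"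
        using lip(3)[of "z + t *\<^sub>R (x - z)" z] xR t lip(1) by (simp add: crit dist_norm)
      also have "\<dots> \<le> L * (1 * norm (x - z))" using tx lip(2) by (intro mult_left_mono) auto
      finally show "norm (grad f (z + t *\<^sub>R (x - z))) \<le> L * norm (x - z)" by simp
    qed simp
    also have "\<dots> = L / \<eta>\<^sup>2 * (\<eta> * norm (x - z))\<^sup>2"
      using \<open>0 < \<eta>\<close> by (simp add: power2_eq_square field_simps)
    also have "\<dots> \<le> L / \<eta>\<^sup>2 * a\<^sup>2"
      using a lip \<open>0 < \<eta>\<close> by (intro mult_left_mono power_mono) auto
    also have "\<dots> < real K * c * a\<^sup>2"
    proof (rule mult_strict_right_mono)
      show "L / \<eta>\<^sup>2 < real K * c" using K by (simp only: pos_divide_less_eq[OF c])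
      \<comment> \<open>The strict cone inequality gives \<open>a > 0\<close>, hence a strict drop
        below \<open>f z\<close>.\<close>
      have "0 \<le> \<eta> * norm (x - z)" using \<open>0 < \<eta>\<close> by simp
      then show "0 < a\<^sup>2" using a by simp
    qed
    finally have "f (X K) < f z" using fK by (simp add: mult_ac)
    then show ?thesis unfolding X_def by (rule non_convergence_domain_if_below[OF diff par])
  qed
  with r show ?thesis using that by blast
qed

section \<open>Choice of the open sets and their density\<close>

theorem theorem2p3:
  fixes f :: "real ^ 'm \<Rightarrow> real"
    and \<delta>\<^sub>0 \<alpha> \<beta> :: real
    and z :: "real ^ 'm"
  assumes "C1_on UNIV f"
    and "\<delta>\<^sub>0 > 0"
    and "0 < \<alpha>" "\<alpha> < 1"
    and "0 < \<beta>" "\<beta> < 1"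
    and "generalised_saddle_point f z"
  shows "\<exists>U :: real \<Rightarrow> (real ^ 'm) set.
    (\<forall>\<epsilon>>0. open (U \<epsilon>) \<and> U \<epsilon> \<noteq> {} \<and>
       U \<epsilon> \<subseteq> non_convergence_domain \<alpha> \<beta> f \<delta>\<^sub>0 z \<inter> ball z \<epsilon>) \<and>
    ((\<lambda>\<epsilon>. measure lebesgue (U \<epsilon>) / measure lebesgue (ball z \<epsilon>)) \<longlongrightarrow> 1) (at_right 0)"
proof -
  have diff: "f differentiable at x" for x
    using assms(1) by (simp add: C1_on_def differentiable_on_eq_differentiable_at)
  obtain S where crit: "grad f z = 0" and S: "open S" "z \<in> S" "C2_on S f"
    using assms(7) unfolding generalised_saddle_point_def by blast
  obtain \<mu> where \<mu>: "0 < \<mu>" "eigenvalue (hessian f z) (- \<mu>)"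
    using assms(7) unfolding generalised_saddle_point_def by (metis neg_0_less_iff_less minus_minus)
  obtain w where w: "norm w = 1" "\<And>x. (hessian f z *v x) \<bullet> w = - \<mu> * (x \<bullet> w)"
    using left_eigenvector[OF \<mu>(2)] by metis
  obtain R L where lip: "0 < R" "0 < L"
    "\<And>x y. x \<in> ball z R \<Longrightarrow> y \<in> ball z R \<Longrightarrow> norm (grad f x - grad f y) \<le> L * norm (x - y)"
    using C2_on_grad_lipschitz[OF S] by metis
  have "grad f differentiable at z"
    using S by (simp add: C2_on_def differentiable_on_eq_differentiable_at)
  then have der: "(grad f has_derivative (*v) (hessian f z)) (at z)"
    unfolding hessian_def by (simp add: jacobian_works)
  let ?D = "non_convergence_domain \<alpha> \<beta> f \<delta>\<^sub>0 z"
  have escape: "\<exists>r>0. double_cone z w \<eta> \<inter> ball z r \<subseteq> ?D" if "0 < \<eta>" for \<eta>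
    using double_cone_escapes[OF diff assms(2-6) crit lip der w \<mu>(1) that] by metis
  \<comment> \<open>The largest open candidate: a single family containing the small cones of every
    aperture, so \<eta> can be chosen after the density bound \<open>b\<close>.\<close>
  define U where "U \<epsilon> = interior (?D \<inter> ball z \<epsilon>)" for \<epsilon>
  have U_cone: "double_cone z w \<eta> \<inter> ball z \<rho> \<subseteq> U \<epsilon>"
    if "double_cone z w \<eta> \<inter> ball z r \<subseteq> ?D" "\<rho> \<le> r" "\<rho> \<le> \<epsilon>" for \<eta> r \<rho> \<epsilon>
    unfolding U_def using that by (intro interior_maximal open_Int open_double_cone open_ball) auto
  have U_lmeasurable: "U \<epsilon> \<in> lmeasurable" for \<epsilon>
    unfolding U_def by (intro lmeasurable_open open_interior bounded_interior bounded_Int) auto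
  have nonempty: "U \<epsilon> \<noteq> {}" if \<epsilon>: "0 < \<epsilon>" for \<epsilon>
  proof -
    \<comment> \<open>Any positive aperture below 1 would do, as the cone then contains the
      direction \<open>w\<close> itself.\<close>
    obtain r where r: "0 < r" "double_cone z w (1/2) \<inter> ball z r \<subseteq> ?D"
      using escape[of "1/2"] by auto
    define \<rho> where "\<rho> = min r \<epsilon>"
    have "0 < \<rho>" using r \<epsilon> by (simp add: \<rho>_def)
    then have "z + (\<rho> / 2) *\<^sub>R w \<in> double_cone z w (1/2) \<inter> ball z \<rho>"
      using w(1) by (simp add: double_cone_def dist_norm power2_norm_eq_inner[symmetric])
    with U_cone[OF r(2), of \<rho> \<epsilon>] show ?thesis by (auto simp: \<rho>_def)
  qed
  have "((\<lambda>\<epsilon>. measure lebesgue (U \<epsilon>) / measure lebesgue (ball z \<epsilon>)) \<longlongrightarrow> 1) (at_right 0)"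
  proof (rule order_tendstoI)
    fix b :: real assume "b < 1"
    \<comment> \<open>The ratio of cone to ball is independent of the radius, so an aperture with
      ratio above \<open>b\<close> on the unit ball works for all small \<epsilon>.\<close>
    let ?q = "\<lambda>n. measure lebesgue (double_cone 0 w (inverse (real (Suc n))) \<inter> ball 0 1) /
      measure lebesgue (ball (0 :: real ^ 'm) 1)"
    have "?q \<longlonglongrightarrow> measure lebesgue (ball (0 :: real ^ 'm) 1) / measure lebesgue (ball (0 :: real ^ 'm) 1)"
      using w by (intro tendsto_divide tendsto_const double_cone_volume_tendsto) auto
    then have "?q \<longlonglongrightarrow> 1" by simp
    then have "\<forall>\<^sub>F n in sequentially. b < ?q n" using \<open>b < 1\<close> by (rule order_tendstoD)
    then obtain n where n: "b < ?q n" by (auto simp: eventually_sequentially)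
    define \<eta> where "\<eta> = inverse (real (Suc n))"
    obtain r where r: "0 < r" "double_cone z w \<eta> \<inter> ball z r \<subseteq> ?D"
      using escape[of \<eta>] by (auto simp: \<eta>_def)
    have "b < measure lebesgue (U \<epsilon>) / measure lebesgue (ball z \<epsilon>)" if \<epsilon>: "0 < \<epsilon>" "\<epsilon> < r" for \<epsilon>
    proof -
      have "measure lebesgue (double_cone z w \<eta> \<inter> ball z \<epsilon>) \<le> measure lebesgue (U \<epsilon>)"
        using U_cone[OF r(2)] U_lmeasurable \<epsilon>
        by (intro measure_mono_fmeasurable) (auto intro!: fmeasurableD lmeasurable_open open_double_cone)
      then have "measure lebesgue (double_cone z w \<eta> \<inter> ball z \<epsilon>) / measure lebesgue (ball z \<epsilon>)
        \<le> measure lebesgue (U \<epsilon>) / measure lebesgue (ball z \<epsilon>)"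
        by (simp add: divide_right_mono)
      then show ?thesis using n measure_double_cone_ball[OF \<epsilon>(1), of z w \<eta>] by (simp add: \<eta>_def)
    qed
    then show "\<forall>\<^sub>F \<epsilon> in at_right 0. b < measure lebesgue (U \<epsilon>) / measure lebesgue (ball z \<epsilon>)"
      using r(1) unfolding eventually_at_right_field by blast
  next
    fix b :: real assume "1 < b"
    have "measure lebesgue (U \<epsilon>) \<le> measure lebesgue (ball z \<epsilon>)" for \<epsilon>
      using interior_subset[of "?D \<inter> ball z \<epsilon>"] U_lmeasurable[of \<epsilon>]
      by (intro measure_mono_fmeasurable) (auto simp: U_def intro: fmeasurableD)
    \<comment> \<open>This also covers \<epsilon> \<le> 0: the ball is empty and division by 0 gives
      0.\<close>
    then have "measure lebesgue (U \<epsilon>) / measure lebesgue (ball z \<epsilon>) \<le> 1" for \<epsilon>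
      by (simp add: divide_le_eq_1 less_le measure_nonneg)
    then show "\<forall>\<^sub>F \<epsilon> in at_right 0. measure lebesgue (U \<epsilon>) / measure lebesgue (ball z \<epsilon>) < b"
      using \<open>1 < b\<close> by (intro always_eventually allI) (rule le_less_trans)
  qed
  moreover have "open (U \<epsilon>)" "U \<epsilon> \<subseteq> ?D \<inter> ball z \<epsilon>" for \<epsilon>
    unfolding U_def by (rule open_interior, rule interior_subset)
  ultimately show ?thesis using nonempty by blast
qed

end
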